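(* Let $n\ge 3$ be odd. The mean distance of the non-commuting graph $\Gamma_{D_{2n}}$ is $\mu(\Gamma_{D_{2n}})=\dfrac{5n-4}{4n-2}$.
   Context: $D_{2n}=\langle r,s : r^n=s^2=1,\ srs=r^{-1}\rangle$ is the dihedral group of order $2n$, and $Z(D_{2n})$ is its center. $\Gamma_{D_{2n}}$ is the simple undirected graph with vertex set $D_{2n}-Z(D_{2n})$ in which two distinct vertices $x,y$ are adjacent if and only if $xy\neq yx$. For a graph $\Gamma$, $d(u,v)$ is the length of a shortest $u$–$v$ path; the transmission of a vertex $v$ is $\sigma(v,\Gamma)=\sum_{u\in V(\Gamma)}d(u,v)$; the transmission of $\Gamma$ is $\sigma(\Gamma)=\sum_{u\in V(\Gamma)}\sigma(u,\Gamma)$; and the mean (average) distance of $\Gamma$ is $\mu(\Gamma)=\frac{\sigma(\Gamma)}{p(p-1)}$, where $p=|V(\Gamma)|$. *)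

theory Defs
  imports "HOL-Algebra.Algebra" "Graph_Theory.Graph_Theory"
begin

section \<open>Group presentations\<close>

text \<open>A word is a list of letters; \<open>(g, True)\<close> stands for the generator \<open>g\<close> and
  \<open>(g, False)\<close> for its formal inverse.\<close>

type_synonym 'g word = "('g \<times> bool) list"

text \<open>The least congruence on words that contains free cancellation and the relations
  \<open>u = v\<close> for \<open>(u, v) \<in> R\<close>.\<close>

inductive_set pres_cong :: "('g word \<times> 'g word) set \<Rightarrow> ('g word \<times> 'g word) set"
  for R :: "('g word \<times> 'g word) set" where
  refl: "(w, w) \<in> pres_cong R"
| sym: "(u, v) \<in> pres_cong R \<Longrightarrow> (v, u) \<in> pres_cong R"
| trans: "(u, v) \<in> pres_cong R \<Longrightarrow> (v, w) \<in> pres_cong R \<Longrightarrow> (u, w) \<in> pres_cong R"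
| app: "(u, v) \<in> pres_cong R \<Longrightarrow> (u', v') \<in> pres_cong R \<Longrightarrow> (u @ u', v @ v') \<in> pres_cong R"
| cancel: "([(g, b), (g, \<not> b)], []) \<in> pres_cong R"
| rel: "(u, v) \<in> R \<Longrightarrow> (u, v) \<in> pres_cong R"

text \<open>The group presented by all elements of the type \<open>'g\<close> as generators, subject to the
  relations \<open>R\<close>; equivalently, the free group on \<open>'g\<close> modulo the normal closure of \<open>R\<close>.\<close>

definition presented_group :: "('g word \<times> 'g word) set \<Rightarrow> 'g word set monoid" where
  "presented_group R =
    \<lparr> carrier = UNIV // pres_cong R,
      monoid.mult = (\<lambda>A B. \<Union>a\<in>A. \<Union>b\<in>B. pres_cong R `` {a @ b}),
      monoid.one = pres_cong R `` {[]} \<rparr>"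

section \<open>Dihedral groups\<close>

datatype dihedral_gen = Rot | Refl

text \<open>The relations \<open>r ^ n = 1\<close>, \<open>s ^ 2 = 1\<close> and \<open>s r s = r\<^sup>-\<^sup>1\<close>, where \<open>r\<close> is \<open>Rot\<close> and
  \<open>s\<close> is \<open>Refl\<close>.\<close>

definition dihedral_rels :: "nat \<Rightarrow> (dihedral_gen word \<times> dihedral_gen word) set" where
  "dihedral_rels n =
    {(replicate n (Rot, True), []),
     (replicate 2 (Refl, True), []),
     ([(Refl, True), (Rot, True), (Refl, True)], [(Rot, False)])}"

text \<open>The dihedral group of order \<open>2 * n\<close>, see \<open>order_dihedral_group\<close> below.\<close>

definition dihedral_group :: "nat \<Rightarrow> dihedral_gen word set monoid" where
  "dihedral_group n = presented_group (dihedral_rels n)"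

section \<open>Non-commuting graphs\<close>

definition group_center :: "('a, 'b) monoid_scheme \<Rightarrow> 'a set" where
  "group_center G = {z \<in> carrier G. \<forall>x \<in> carrier G. z \<otimes>\<^bsub>G\<^esub> x = x \<otimes>\<^bsub>G\<^esub> z}"

text \<open>An undirected simple graph is a loop-free symmetric digraph without parallel arcs:
  each edge \<open>{x, y}\<close> is represented by the two arcs \<open>(x, y)\<close> and \<open>(y, x)\<close>.\<close>

definition noncommuting_graph :: "('a, 'b) monoid_scheme \<Rightarrow> 'a pair_pre_digraph" where
  "noncommuting_graph G =
    \<lparr> pverts = carrier G - group_center G,
      parcs = {(x, y). x \<in> carrier G - group_center G \<and> y \<in> carrier G - group_center G \<and>
                 x \<noteq> y \<and> x \<otimes>\<^bsub>G\<^esub> y \<noteq> y \<otimes>\<^bsub>G\<^esub> x} \<rparr>"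

section \<open>Mean distance\<close>

text \<open>The length of a shortest walk, i.e. its cost for unit weights; it is \<open>\<infinity>\<close> if there is
  none.\<close>

definition graph_dist :: "('a, 'b) pre_digraph \<Rightarrow> 'a \<Rightarrow> 'a \<Rightarrow> ereal" where
  "graph_dist G u v = wf_digraph.\<mu> G (\<lambda>_. 1) u v"

definition vertex_transmission :: "('a, 'b) pre_digraph \<Rightarrow> 'a \<Rightarrow> ereal" where
  "vertex_transmission G v = (\<Sum>u\<in>verts G. graph_dist G u v)"

definition transmission :: "('a, 'b) pre_digraph \<Rightarrow> ereal" where
  "transmission G = (\<Sum>u\<in>verts G. vertex_transmission G u)"

definition mean_distance :: "('a, 'b) pre_digraph \<Rightarrow> ereal" where
  "mean_distance G =
    transmission G / ereal (real (card (verts G)) * (real (card (verts G)) - 1))"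

section \<open>Basic facts\<close>

lemma equiv_pres_cong: "equiv UNIV (pres_cong R)"
  by (intro equivI refl_onI symI transI) (auto intro: pres_cong.intros)

lemma presented_group_mult:
  "(pres_cong R `` {u}) \<otimes>\<^bsub>presented_group R\<^esub> (pres_cong R `` {v}) = pres_cong R `` {u @ v}"
proof -
  have "pres_cong R `` {a @ b} = pres_cong R `` {u @ v}"
    if "(u, a) \<in> pres_cong R" "(v, b) \<in> pres_cong R" for a b
    using equiv_class_eq[OF equiv_pres_cong pres_cong.app[OF that]] by simp
  then have "(\<Union>a\<in>pres_cong R `` {u}. \<Union>b\<in>pres_cong R `` {v}. pres_cong R `` {a @ b})
      = (\<Union>a\<in>pres_cong R `` {u}. \<Union>b\<in>pres_cong R `` {v}. pres_cong R `` {u @ v})"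
    by auto
  also have "\<dots> = pres_cong R `` {u @ v}"
    using pres_cong.refl[of u R] pres_cong.refl[of v R] by auto
  finally show ?thesis by (simp add: presented_group_def)
qed

lemma pres_cong_inv_left: "(map (apsnd Not) (rev w) @ w, []) \<in> pres_cong R"
proof (induction w)
  case Nil
  show ?case by (simp add: pres_cong.refl)
next
  case (Cons x w)
  obtain g b where x: "x = (g, b)" by force
  let ?i = "map (apsnd Not) (rev w)"
  have c: "([(g, \<not> b), (g, b)], []) \<in> pres_cong R"
    using pres_cong.cancel[of g "\<not> b" R] by simp
  have "(?i @ ([(g, \<not> b), (g, b)] @ w), ?i @ ([] @ w)) \<in> pres_cong R"
    by (intro pres_cong.app pres_cong.refl c)
  then show ?case
    using pres_cong.trans[OF _ Cons] x by simp
qed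

lemma group_presented_group: "group (presented_group R)"
proof (rule groupI)
  fix x assume "x \<in> carrier (presented_group R)"
  then obtain u where u: "x = pres_cong R `` {u}"
    by (auto simp: presented_group_def elim: quotientE)
  have "pres_cong R `` {map (apsnd Not) (rev u)} \<otimes>\<^bsub>presented_group R\<^esub> x = \<one>\<^bsub>presented_group R\<^esub>"
    unfolding u presented_group_mult
    using equiv_class_eq[OF equiv_pres_cong pres_cong_inv_left]
    by (simp add: presented_group_def)
  then show "\<exists>y\<in>carrier (presented_group R). y \<otimes>\<^bsub>presented_group R\<^esub> x = \<one>\<^bsub>presented_group R\<^esub>"
    by (intro bexI) (auto simp: presented_group_def intro: quotientI)
next
  fix x y assume "x \<in> carrier (presented_group R)" "y \<in> carrier (presented_group R)"
  then obtain u v where uv: "x = pres_cong R `` {u}" "y = pres_cong R `` {v}"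
    by (auto simp: presented_group_def elim!: quotientE)
  then show "x \<otimes>\<^bsub>presented_group R\<^esub> y \<in> carrier (presented_group R)"
    unfolding uv presented_group_mult by (auto simp: presented_group_def intro: quotientI)
  fix z assume "z \<in> carrier (presented_group R)"
  then obtain w where w: "z = pres_cong R `` {w}"
    by (auto simp: presented_group_def elim!: quotientE)
  show "x \<otimes>\<^bsub>presented_group R\<^esub> y \<otimes>\<^bsub>presented_group R\<^esub> z
      = x \<otimes>\<^bsub>presented_group R\<^esub> (y \<otimes>\<^bsub>presented_group R\<^esub> z)"
    unfolding uv w presented_group_mult by simp
next
  show "\<one>\<^bsub>presented_group R\<^esub> \<in> carrier (presented_group R)"
    by (auto simp: presented_group_def intro: quotientI)
next
  fix x assume "x \<in> carrier (presented_group R)"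
  then obtain u where u: "x = pres_cong R `` {u}"
    by (auto simp: presented_group_def elim: quotientE)
  have "\<one>\<^bsub>presented_group R\<^esub> = pres_cong R `` {[]}"
    by (simp add: presented_group_def)
  then show "\<one>\<^bsub>presented_group R\<^esub> \<otimes>\<^bsub>presented_group R\<^esub> x = x"
    unfolding u by (simp add: presented_group_mult)
qed

lemma pair_bidirected_noncommuting_graph:
  "pair_bidirected_digraph (noncommuting_graph G)"
proof -
  have "symmetric (with_proj (noncommuting_graph G))"
    unfolding symmetric_def with_proj_simps
    by (rule symI) (auto simp: noncommuting_graph_def)
  then show ?thesis
    by unfold_locales (auto simp: noncommuting_graph_def)
qed

text \<open>A pair \<open>(i, f)\<close> encodes the element \<open>r ^ i * s ^ (if f then 1 else 0)\<close>, on which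
  letters act by left multiplication.\<close>

fun dihedral_act :: "nat \<Rightarrow> dihedral_gen \<times> bool \<Rightarrow> nat \<times> bool \<Rightarrow> nat \<times> bool" where
  "dihedral_act n (Rot, True) (i, f) = ((i + 1) mod n, f)"
| "dihedral_act n (Rot, False) (i, f) = ((i + (n - 1)) mod n, f)"
| "dihedral_act n (Refl, b) (i, f) = ((n - i) mod n, \<not> f)"

fun dihedral_nf :: "nat \<times> bool \<Rightarrow> dihedral_gen word" where
  "dihedral_nf (i, f) = replicate i (Rot, True) @ (if f then [(Refl, True)] else [])"

lemma dihedral_act_closed:
  assumes "n > 0"
  shows "dihedral_act n a x \<in> {..<n} \<times> UNIV"
  using assms by (cases "(n, a, x)" rule: dihedral_act.cases) auto

lemma foldr_dihedral_act_closed: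
  assumes "n > 0" "x \<in> {..<n} \<times> UNIV"
  shows "foldr (dihedral_act n) w x \<in> {..<n} \<times> UNIV"
  using assms by (induction w) (auto simp: dihedral_act_closed simp del: mem_Times_iff)

lemma foldr_dihedral_act_rot:
  assumes "n > 0"
  shows "i < n \<Longrightarrow> foldr (dihedral_act n) (replicate k (Rot, True)) (i, f) = ((i + k) mod n, f)"
  by (induction k) (auto simp: mod_Suc_eq)

lemma dihedral_act_cong:
  assumes "n > 0" "(u, v) \<in> pres_cong (dihedral_rels n)"
  shows "x \<in> {..<n} \<times> UNIV \<Longrightarrow> foldr (dihedral_act n) u x = foldr (dihedral_act n) v x"
  using assms(2)
proof (induction arbitrary: x rule: pres_cong.induct)
  case (app u v u' v')
  then show ?case using foldr_dihedral_act_closed[OF assms(1)] by simp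
next
  case (cancel g b)
  obtain i f where x: "x = (i, f)" "i < n" using cancel by auto
  show ?case
  proof (cases g)
    case Refl
    have "(n - (n - i) mod n) mod n = i"
      using x by (cases "i = 0") auto
    then show ?thesis by (simp add: Refl x)
  next
    case Rot
    have 1: "((i + (n - 1)) mod n + 1) mod n = i"
    proof -
      have "((i + (n - 1)) mod n + 1) mod n = (i + (n - 1) + 1) mod n"
        by (rule mod_add_left_eq)
      also have "i + (n - 1) + 1 = i + n"
        using assms(1) by simp
      finally show ?thesis using x by simp
    qed
    have 2: "((i + 1) mod n + (n - 1)) mod n = i"
    proof -
      have "((i + 1) mod n + (n - 1)) mod n = (i + 1 + (n - 1)) mod n"
        by (rule mod_add_left_eq)
      also have "i + 1 + (n - 1) = i + n"
        using assms(1) by simp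
      finally show ?thesis using x by simp
    qed
    show ?thesis
      using 1 2 by (cases b) (simp_all only: Rot x foldr.simps comp_def id_def dihedral_act.simps not_True_eq_False not_False_eq_True)
  qed
next
  case (rel u v)
  obtain i f where x: "x = (i, f)" "i < n" using rel by auto
  have *: "(n - (n - i) mod n) mod n = i"
    using x by (cases "i = 0") auto
  have **: "(n - Suc ((n - i) mod n) mod n) mod n = (i + (n - 1)) mod n"
  proof (cases "i = 0")
    case True
    then show ?thesis using x by (cases "n = 1") auto
  next
    case False
    then obtain m where m: "i = Suc m" by (cases i) auto
    then have "i + (n - 1) = m + n" using x by simp
    then have 1: "(i + (n - 1)) mod n = m" using m x by (simp only: mod_add_self2 mod_less)
    have "(n - i) mod n = n - i" using m x by simp
    moreover have "Suc (n - i) = n - m" using m x by simp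
    moreover have "(n - (n - m) mod n) mod n = m"
      using m x by (cases "m = 0") simp_all
    ultimately show ?thesis unfolding 1 by (simp only:)
  qed
  from rel consider "u = replicate n (Rot, True)" "v = []"
    | "u = replicate 2 (Refl, True)" "v = []"
    | "u = [(Refl, True), (Rot, True), (Refl, True)]" "v = [(Rot, False)]"
    unfolding dihedral_rels_def by blast
  then show ?case
  proof cases
    case 1
    then show ?thesis using foldr_dihedral_act_rot[OF assms(1) x(2)] x by simp
  next
    case 2
    then show ?thesis using x * by (simp add: numeral_2_eq_2)
  next
    case 3
    then show ?thesis using x ** by simp
  qed
qed auto

lemma pres_cong_ctx:
  "(u, v) \<in> pres_cong R \<Longrightarrow> (a @ u @ b, a @ v @ b) \<in> pres_cong R"
  by (intro pres_cong.app pres_cong.refl)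

lemma dihedral_nf_act:
  assumes "n > 0" "x \<in> {..<n} \<times> UNIV"
  shows "(a # dihedral_nf x, dihedral_nf (dihedral_act n a x)) \<in> pres_cong (dihedral_rels n)"
proof -
  let ?C = "pres_cong (dihedral_rels n)"
  note tr = pres_cong.trans and sy = pres_cong.sym and re = pres_cong.refl
  let ?r = "(Rot, True)" and ?q = "(Rot, False)" and ?s = "(Refl, True)"
  have rn: "(replicate n ?r, []) \<in> ?C" and ss: "([?s, ?s], []) \<in> ?C"
    and srs: "([?s, ?r, ?s], [?q]) \<in> ?C"
    by (auto intro!: pres_cong.rel simp: dihedral_rels_def numeral_2_eq_2)
  have qr: "([?q, ?r], []) \<in> ?C" and rq: "([?r, ?q], []) \<in> ?C"
    using pres_cong.cancel[of Rot False] pres_cong.cancel[of Rot True] by auto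
  have s': "([(Refl, False)], [?s]) \<in> ?C"
  proof -
    have 1: "([(Refl, False)] @ [?s, ?s] @ [], [(Refl, False)] @ [] @ []) \<in> ?C"
      by (rule pres_cong_ctx[OF ss])
    have 2: "([] @ [(Refl, False), ?s] @ [?s], [] @ [] @ [?s]) \<in> ?C"
      using pres_cong.cancel[of Refl False] by (intro pres_cong_ctx) simp
    show ?thesis using tr[OF sy[OF 1]] 2 by simp
  qed
  have qpow: "(replicate i ?q, replicate (n - i) ?r) \<in> ?C" if "i \<le> n" for i
    using that
  proof (induction i)
    case 0
    then show ?case using sy[OF rn] by simp
  next
    case (Suc i)
    then have "n - i = Suc (n - Suc i)" by simp
    then have e: "replicate (n - i) ?r = ?r # replicate (n - Suc i) ?r" by simp
    have 1: "([?q] @ replicate i ?q @ [], [?q] @ replicate (n - i) ?r @ []) \<in> ?C"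
      using Suc by (intro pres_cong_ctx) simp
    have 2: "([] @ [?q, ?r] @ replicate (n - Suc i) ?r, [] @ [] @ replicate (n - Suc i) ?r) \<in> ?C"
      by (rule pres_cong_ctx[OF qr])
    show ?case using tr[OF 1[unfolded e]] 2 by simp
  qed
  have sr: "([?s, ?r], [?q, ?s]) \<in> ?C"
  proof -
    have 1: "([?s, ?r] @ [?s, ?s] @ [], [?s, ?r] @ [] @ []) \<in> ?C"
      by (rule pres_cong_ctx[OF ss])
    have 2: "([] @ [?s, ?r, ?s] @ [?s], [] @ [?q] @ [?s]) \<in> ?C"
      by (rule pres_cong_ctx[OF srs])
    show ?thesis using tr[OF sy[OF 1]] 2 by simp
  qed
  have spow: "(?s # replicate i ?r, replicate i ?q @ [?s]) \<in> ?C" for i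
  proof (induction i)
    case 0
    show ?case by (simp add: re)
  next
    case (Suc i)
    have 1: "([] @ [?s, ?r] @ replicate i ?r, [] @ [?q, ?s] @ replicate i ?r) \<in> ?C"
      by (rule pres_cong_ctx[OF sr])
    have 2: "([?q] @ (?s # replicate i ?r) @ [], [?q] @ (replicate i ?q @ [?s]) @ []) \<in> ?C"
      by (rule pres_cong_ctx[OF Suc])
    show ?case using tr[OF 1] 2 by simp
  qed
  obtain i f where x: "x = (i, f)" "i < n" using assms(2) by auto
  define t where "t = (if f then [?s] else [])"
  have nf: "dihedral_nf x = replicate i ?r @ t" by (simp add: x t_def)
  have red: "(replicate (j mod n) ?r, replicate j ?r) \<in> ?C" if "j \<le> n" for j
    using that sy[OF rn] by (cases "j = n") (auto simp: re)
  have Rot_pos: ?thesis if "a = ?r"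
  proof -
    have "([] @ replicate (Suc i mod n) ?r @ t, [] @ replicate (Suc i) ?r @ t) \<in> ?C"
      using x red[of "Suc i"] by (intro pres_cong_ctx) simp
    from sy[OF this] show ?thesis using that x by (simp add: t_def)
  qed
  have Rot_neg: ?thesis if "a = ?q"
  proof (cases i)
    case 0
    have "([] @ [?q] @ t, [] @ replicate (n - 1) ?r @ t) \<in> ?C"
      using qpow[of 1] assms(1) by (intro pres_cong_ctx) simp
    then show ?thesis using that x 0 assms(1) by (simp add: t_def)
  next
    case (Suc j)
    have e: "(Suc j + (n - 1)) mod n = j"
      using Suc x by simp
    have "([] @ [?q, ?r] @ (replicate j ?r @ t), [] @ [] @ (replicate j ?r @ t)) \<in> ?C"
      by (rule pres_cong_ctx[OF qr])
    then show ?thesis using that x Suc e by (simp add: t_def)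
  qed
  have Refl_pos: "(?s # dihedral_nf x, dihedral_nf (dihedral_act n (Refl, b) x)) \<in> ?C" for b
  proof -
    have 1: "([] @ (?s # replicate i ?r) @ t, [] @ (replicate i ?q @ [?s]) @ t) \<in> ?C"
      by (rule pres_cong_ctx[OF spow])
    have "(replicate i ?q, replicate ((n - i) mod n) ?r) \<in> ?C"
      using tr[OF qpow[of i] sy[OF red[of "n - i"]]] x by simp
    then have 2: "([] @ replicate i ?q @ ([?s] @ t), [] @ replicate ((n - i) mod n) ?r @ ([?s] @ t)) \<in> ?C"
      by (rule pres_cong_ctx)
    have "([?s] @ t, if f then [] else [?s]) \<in> ?C"
      using ss re by (auto simp: t_def)
    then have 3: "(replicate ((n - i) mod n) ?r @ ([?s] @ t) @ [],
        replicate ((n - i) mod n) ?r @ (if f then [] else [?s]) @ []) \<in> ?C"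
      by (rule pres_cong_ctx)
    have "(?s # dihedral_nf x, replicate ((n - i) mod n) ?r @ (if f then [] else [?s])) \<in> ?C"
      using tr[OF 1[simplified] tr[OF 2[simplified] 3[simplified]]] by (simp add: nf)
    then show ?thesis by (cases f) (simp_all add: x)
  qed
  have Refl_neg: "((Refl, False) # dihedral_nf x, ?s # dihedral_nf x) \<in> ?C"
    using pres_cong_ctx[OF s', of "[]" "dihedral_nf x"] by simp
  show ?thesis
  proof (cases a)
    case (Pair g b)
    then show ?thesis
      using Rot_pos Rot_neg Refl_pos[of True] tr[OF Refl_neg Refl_pos[of False]]
      by (cases g; cases b) simp_all
  qed
qed

lemma dihedral_nf_cong:
  assumes "n > 0"
  shows "(w, dihedral_nf (foldr (dihedral_act n) w (0, False))) \<in> pres_cong (dihedral_rels n)"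
proof (induction w)
  case Nil
  show ?case by (simp add: pres_cong.refl)
next
  case (Cons a w)
  let ?x = "foldr (dihedral_act n) w (0, False)"
  have 1: "([a] @ w @ [], [a] @ dihedral_nf ?x @ []) \<in> pres_cong (dihedral_rels n)"
    by (rule pres_cong_ctx[OF Cons])
  have "?x \<in> {..<n} \<times> UNIV"
    using assms by (intro foldr_dihedral_act_closed) auto
  then show ?case
    using pres_cong.trans[OF 1] dihedral_nf_act[OF assms, of ?x a] by simp
qed

lemma order_dihedral_group:
  assumes "n > 0"
  shows "order (dihedral_group n) = 2 * n"
proof -
  let ?C = "pres_cong (dihedral_rels n)"
  have "bij_betw (\<lambda>x. ?C `` {dihedral_nf x}) ({..<n} \<times> UNIV) (UNIV // ?C)"
  proof (rule bij_betw_imageI)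
    have ev: "foldr (dihedral_act n) (dihedral_nf x) (0, False) = x" if "x \<in> {..<n} \<times> UNIV" for x
    proof -
      obtain i f where x: "x = (i, f)" "i < n" using \<open>x \<in> _\<close> by auto
      show ?thesis
        using foldr_dihedral_act_rot[OF assms assms] x by auto
    qed
    show "inj_on (\<lambda>x. ?C `` {dihedral_nf x}) ({..<n} \<times> UNIV)"
    proof (rule inj_onI)
      fix x y assume xy: "x \<in> {..<n} \<times> (UNIV :: bool set)" "y \<in> {..<n} \<times> (UNIV :: bool set)"
        and "?C `` {dihedral_nf x} = ?C `` {dihedral_nf y}"
      then have "(dihedral_nf x, dihedral_nf y) \<in> ?C"
        using eq_equiv_class[OF _ equiv_pres_cong] by blast
      then have "foldr (dihedral_act n) (dihedral_nf x) (0, False)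
          = foldr (dihedral_act n) (dihedral_nf y) (0, False)"
        by (rule dihedral_act_cong[OF assms]) (use assms in simp)
      then show "x = y"
        unfolding ev[OF xy(1)] ev[OF xy(2)] .
    qed
    show "(\<lambda>x. ?C `` {dihedral_nf x}) ` ({..<n} \<times> UNIV) = UNIV // ?C"
    proof (intro equalityI subsetI)
      fix A assume "A \<in> UNIV // ?C"
      then obtain w where "A = ?C `` {w}" by (auto elim: quotientE)
      then have "A = ?C `` {dihedral_nf (foldr (dihedral_act n) w (0, False))}"
        using equiv_class_eq[OF equiv_pres_cong dihedral_nf_cong[OF assms]] by simp
      moreover have "foldr (dihedral_act n) w (0, False) \<in> {..<n} \<times> UNIV"
        using assms by (intro foldr_dihedral_act_closed) auto
      ultimately show "A \<in> (\<lambda>x. ?C `` {dihedral_nf x}) ` ({..<n} \<times> UNIV)"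
        by (rule image_eqI)
    next
      fix A assume "A \<in> (\<lambda>x. ?C `` {dihedral_nf x}) ` ({..<n} \<times> UNIV)"
      then show "A \<in> UNIV // ?C"
        by (elim imageE) (simp only: quotientI UNIV_I)
    qed
  qed
  then have "card (UNIV // ?C) = card ({..<n} \<times> (UNIV :: bool set))"
    by (rule bij_betw_same_card[symmetric])
  then show ?thesis
    by (simp add: order_def dihedral_group_def presented_group_def)
qed

end

theory Submission
  imports Defs
begin

text \<open>
  Every element of the dihedral group is uniquely \<open>r ^ i * s ^ e\<close> with \<open>i < n\<close> and \<open>e \<in> {0, 1}\<close>.
  Rotations commute with each other. As \<open>n\<close> is odd, 2 is invertible modulo \<open>n\<close>, so distinct
  nontrivial elements do not commute in any other way: a reflection commutes neither with a nontrivial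
  rotation nor with another reflection (\<open>dihedral_elt_commute_iff\<close>). Hence the center is trivial,
  and the non-commuting graph has \<open>2 n - 1\<close> vertices and all possible edges, except that the
  \<open>n - 1\<close> nontrivial rotations form an independent set (\<open>noncommuting_graph_dihedral\<close>).

  In such a graph two distinct vertices are at distance 1, unless both lie in the independent
  set; then they are at distance 2, since any outside vertex is a common neighbour
  (\<open>graph_dist_complete_split\<close>). So a rotation has transmission \<open>2 (n - 2) + n = 3 n - 4\<close> and a
  reflection \<open>(n - 1) + (n - 1) = 2 n - 2\<close>, which adds up to
  \<open>(n - 1) (3 n - 4) + n (2 n - 2) = (n - 1) (5 n - 4)\<close> (\<open>transmission_complete_split\<close>).
  Dividing by \<open>(2 n - 1) (2 n - 2)\<close> gives the mean distance.
\<close>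

section \<open>Distances in complete split graphs\<close>

lemma (in wf_digraph) awalk_cost_unit: "awalk_cost (\<lambda>_. 1) p = real (length p)"
  by (induction p) auto

lemma (in wf_digraph) graph_dist_refl:
  assumes "u \<in> verts G"
  shows "graph_dist G u u = 0"
proof (rule antisym)
  show "graph_dist G u u \<le> 0"
    using min_cost_le_walk_cost[of u "[]" u "\<lambda>_. 1"] assms
    by (simp add: graph_dist_def awalk_Nil_iff zero_ereal_def)
  show "0 \<le> graph_dist G u u"
    by (auto simp: graph_dist_def \<mu>_def awalk_cost_unit intro: INF_greatest)
qed

lemma (in wf_digraph) graph_dist_adjacent:
  assumes "u \<rightarrow>\<^bsub>G\<^esub> v" "u \<noteq> v"
  shows "graph_dist G u v = 1"
proof (rule antisym)
  obtain e where "awalk u [e] v"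
    using assms(1) by (fastforce simp: awalk_simps arcs_ends_conv)
  from min_cost_le_walk_cost[OF this, of "\<lambda>_. 1"] show "graph_dist G u v \<le> 1"
    by (simp add: graph_dist_def one_ereal_def)
  have "1 \<le> length p" if "awalk u p v" for p
    using that assms(2) by (cases p) (auto simp: awalk_Nil_iff)
  then show "1 \<le> graph_dist G u v"
    by (auto simp: graph_dist_def \<mu>_def awalk_cost_unit one_ereal_def intro!: INF_greatest)
qed

text \<open>The hypotheses exclude walks of length 0 and 1, and the neighbour \<open>w\<close> gives one of length 2.\<close>

lemma (in wf_digraph) graph_dist_common_neighbour:
  assumes "u \<rightarrow>\<^bsub>G\<^esub> w" "w \<rightarrow>\<^bsub>G\<^esub> v" "u \<noteq> v" "\<not> u \<rightarrow>\<^bsub>G\<^esub> v"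
  shows "graph_dist G u v = 2"
proof (rule antisym)
  obtain d where d: "d \<in> arcs G" "tail G d = u" "head G d = w"
    using assms(1) by (auto simp: arcs_ends_conv)
  obtain e where e: "e \<in> arcs G" "tail G e = w" "head G e = v"
    using assms(2) by (auto simp: arcs_ends_conv)
  have "awalk u [d, e] v"
    using d e by (auto simp: awalk_simps)
  from min_cost_le_walk_cost[OF this, of "\<lambda>_. 1"] show "graph_dist G u v \<le> 2"
    by (simp add: graph_dist_def)
  have "2 \<le> length p" if "awalk u p v" for p
  proof (rule ccontr)
    assume "\<not> 2 \<le> length p"
    then consider "p = []" | e where "p = [e]"
      by (cases p; cases "tl p") auto
    then show False
    proof cases
      case 1
      then show False using that assms(3) by (simp add: awalk_Nil_iff)
    next
      case 2
      then show False using that assms(4) by (auto simp: awalk_simps arcs_ends_conv)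
    qed
  qed
  then show "2 \<le> graph_dist G u v"
    by (auto simp: graph_dist_def \<mu>_def awalk_cost_unit intro!: INF_greatest)
qed

text \<open>The vertices of \<open>A\<close> are pairwise nonadjacent, and all other pairs of distinct vertices are
  adjacent. Two vertices of \<open>A\<close> then have every vertex of \<open>B\<close> as a common neighbour.\<close>

lemma (in wf_digraph) graph_dist_complete_split:
  assumes verts: "verts G = A \<union> B" and "A \<inter> B = {}" "B \<noteq> {}"
    and adj: "\<And>u v. u \<in> A \<union> B \<Longrightarrow> v \<in> A \<union> B \<Longrightarrow>
      u \<rightarrow>\<^bsub>G\<^esub> v \<longleftrightarrow> u \<noteq> v \<and> \<not> (u \<in> A \<and> v \<in> A)"
    and "u \<in> A \<union> B" "v \<in> A \<union> B"
  shows "graph_dist G u v = (if u = v then 0 else if u \<in> A \<and> v \<in> A then 2 else 1)"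
proof -
  obtain w where w: "w \<in> B" using assms(3) by blast
  consider "u = v" | "u \<noteq> v" "u \<in> A" "v \<in> A" | "u \<noteq> v" "\<not> (u \<in> A \<and> v \<in> A)"
    by blast
  then show ?thesis
  proof cases
    case 1
    then show ?thesis using graph_dist_refl assms by simp
  next
    case 2
    then have "graph_dist G u v = 2"
      using assms w by (intro graph_dist_common_neighbour[of u w v]) auto
    then show ?thesis using 2 by simp
  next
    case 3
    then show ?thesis using graph_dist_adjacent assms by auto
  qed
qed

text \<open>Each of the \<open>a\<close> independent vertices is at distance 2 from the \<open>a - 1\<close> others and at distance 1
  from \<open>b\<close> vertices; each of the \<open>b\<close> remaining vertices is at distance 1 from all the others.\<close>

lemma (in wf_digraph) transmission_complete_split:
  assumes verts: "verts G = A \<union> B" and AB: "A \<inter> B = {}" "B \<noteq> {}"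
    and fin: "finite A" "finite B"
    and adj: "\<And>u v. u \<in> A \<union> B \<Longrightarrow> v \<in> A \<union> B \<Longrightarrow>
      u \<rightarrow>\<^bsub>G\<^esub> v \<longleftrightarrow> u \<noteq> v \<and> \<not> (u \<in> A \<and> v \<in> A)"
  defines "a \<equiv> real (card A)" and "b \<equiv> real (card B)"
  shows "transmission G = ereal (a * (2 * (a - 1) + b) + b * (a + b - 1))"
proof -
  define d :: "'a \<Rightarrow> 'a \<Rightarrow> real"
    where "d u v = (if u = v then 0 else if u \<in> A \<and> v \<in> A then 2 else 1)" for u v
  have dist: "graph_dist G u v = ereal (d u v)" if "u \<in> A \<union> B" "v \<in> A \<union> B" for u v
    using graph_dist_complete_split[OF verts AB adj that] by (simp add: d_def one_ereal_def)
  have away: "(\<Sum>u\<in>S. if u = v then 0 else c) = c * (real (card S) - 1)"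
    if "finite S" "v \<in> S" for S :: "'a set" and v and c :: real
  proof -
    have "(\<Sum>u\<in>S. if u = v then 0 else c) = (\<Sum>u\<in>S - {v}. c)"
      using that by (intro sum.mono_neutral_cong_right) auto
    moreover have "card S > 0"
      using that by (auto simp: card_gt_0_iff)
    ultimately show ?thesis
      using that by (simp add: of_nat_diff)
  qed
  have A: "(\<Sum>u\<in>A \<union> B. d u v) = 2 * (a - 1) + b" if v: "v \<in> A" for v
  proof -
    have "(\<Sum>u\<in>A. d u v) = (\<Sum>u\<in>A. if u = v then 0 else 2)"
      using v by (intro sum.cong) (auto simp: d_def)
    moreover have "(\<Sum>u\<in>B. d u v) = (\<Sum>u\<in>B. 1)"
      using v AB by (intro sum.cong) (auto simp: d_def)
    ultimately show ?thesis
      using away[OF fin(1) v, of 2] fin AB by (simp add: sum.union_disjoint a_def b_def)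
  qed
  have B: "(\<Sum>u\<in>A \<union> B. d u v) = a + b - 1" if v: "v \<in> B" for v
  proof -
    have "(\<Sum>u\<in>A \<union> B. d u v) = (\<Sum>u\<in>A \<union> B. if u = v then 0 else 1)"
      using v AB by (intro sum.cong) (auto simp: d_def)
    then show ?thesis
      using away[of "A \<union> B" v 1] v fin AB by (simp add: card_Un_disjoint a_def b_def)
  qed
  have "transmission G = (\<Sum>v\<in>A \<union> B. \<Sum>u\<in>A \<union> B. ereal (d u v))"
    unfolding transmission_def vertex_transmission_def verts
    by (intro sum.cong) (auto simp: dist)
  also have "\<dots> = ereal (\<Sum>v\<in>A \<union> B. \<Sum>u\<in>A \<union> B. d u v)"
    by simp
  also have "(\<Sum>v\<in>A \<union> B. \<Sum>u\<in>A \<union> B. d u v) = a * (2 * (a - 1) + b) + b * (a + b - 1)"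
    unfolding sum.union_disjoint[OF fin AB(1), of "\<lambda>v. \<Sum>u\<in>A \<union> B. d u v"]
    by (simp add: A B a_def b_def cong: sum.cong_simp)
  finally show ?thesis .
qed

section \<open>The dihedral group in coordinates\<close>

text \<open>For \<open>i < n\<close> the pairs \<open>(i, f)\<close> serve as unique coordinates of the group elements, so that
  questions about products become arithmetic modulo \<open>n\<close>.\<close>

definition dihedral_elt :: "nat \<Rightarrow> nat \<times> bool \<Rightarrow> dihedral_gen word set" where
  "dihedral_elt n x = pres_cong (dihedral_rels n) `` {dihedral_nf x}"

text \<open>Left multiplication of \<open>r ^ j * s ^ g\<close> by \<open>r ^ i * s ^ f\<close>: by \<open>s r = r\<^sup>-\<^sup>1 s\<close>, moving \<open>s\<close> past
  \<open>r ^ j\<close> turns the exponent into \<open>- j\<close>, which is \<open>n - j\<close> modulo \<open>n\<close>.\<close>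

lemma foldr_dihedral_act_nf:
  assumes "n > 0" "j < n"
  shows "foldr (dihedral_act n) (dihedral_nf (i, f)) (j, g)
    = (((if f then n - j else j) + i) mod n, f \<noteq> g)"
proof (cases f)
  case True
  have "foldr (dihedral_act n) (dihedral_nf (i, f)) (j, g)
      = foldr (dihedral_act n) (replicate i (Rot, True)) ((n - j) mod n, \<not> g)"
    using True by simp
  also have "\<dots> = (((n - j) mod n + i) mod n, \<not> g)"
    using assms by (intro foldr_dihedral_act_rot) auto
  finally show ?thesis using True by (simp add: mod_add_left_eq)
next
  case False
  then show ?thesis using foldr_dihedral_act_rot[OF assms] by simp
qed

text \<open>Evaluating a word by its action on the identity \<open>(0, False)\<close> computes the coordinates of the
  element that it represents.\<close>

lemma dihedral_elt_eval:
  assumes "n > 0"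
  shows "pres_cong (dihedral_rels n) `` {w}
    = dihedral_elt n (foldr (dihedral_act n) w (0, False))"
  unfolding dihedral_elt_def
  by (rule equiv_class_eq[OF equiv_pres_cong dihedral_nf_cong[OF assms]])

lemma foldr_dihedral_nf_one:
  assumes "i < n"
  shows "foldr (dihedral_act n) (dihedral_nf (i, f)) (0, False) = (i, f)"
  using foldr_dihedral_act_nf[of n 0 i f False] assms by (auto split: if_splits)

text \<open>Congruent words act in the same way, and the action on the identity recovers the coordinates
  from the normal form.\<close>

lemma inj_on_dihedral_elt: "inj_on (dihedral_elt n) ({..<n} \<times> UNIV)"
proof (rule inj_onI)
  fix x y assume xy: "x \<in> {..<n} \<times> (UNIV :: bool set)" "y \<in> {..<n} \<times> (UNIV :: bool set)"
    and "dihedral_elt n x = dihedral_elt n y"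
  then have "(dihedral_nf x, dihedral_nf y) \<in> pres_cong (dihedral_rels n)"
    unfolding dihedral_elt_def using eq_equiv_class[OF _ equiv_pres_cong] by blast
  then have "foldr (dihedral_act n) (dihedral_nf x) (0, False)
      = foldr (dihedral_act n) (dihedral_nf y) (0, False)"
    using xy by (intro dihedral_act_cong) auto
  then show "x = y"
    using xy by (cases x; cases y) (simp add: foldr_dihedral_nf_one del: dihedral_nf.simps)
qed

lemma carrier_dihedral_group:
  assumes "n > 0"
  shows "carrier (dihedral_group n) = dihedral_elt n ` ({..<n} \<times> UNIV)"
proof (intro equalityI subsetI)
  fix A assume "A \<in> carrier (dihedral_group n)"
  then obtain w where "A = pres_cong (dihedral_rels n) `` {w}"
    by (auto simp: dihedral_group_def presented_group_def elim: quotientE)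
  moreover have "foldr (dihedral_act n) w (0, False) \<in> {..<n} \<times> UNIV"
    using assms by (intro foldr_dihedral_act_closed) auto
  ultimately show "A \<in> dihedral_elt n ` ({..<n} \<times> UNIV)"
    by (simp only: dihedral_elt_eval[OF assms] imageI)
next
  fix A assume "A \<in> dihedral_elt n ` ({..<n} \<times> UNIV)"
  then show "A \<in> carrier (dihedral_group n)"
    by (auto simp: dihedral_elt_def dihedral_group_def presented_group_def intro: quotientI)
qed

lemma dihedral_elt_mult:
  assumes "i < n" "j < n"
  shows "dihedral_elt n (i, f) \<otimes>\<^bsub>dihedral_group n\<^esub> dihedral_elt n (j, g)
    = dihedral_elt n (((if f then n - j else j) + i) mod n, f \<noteq> g)"
proof -
  have n: "n > 0" using assms by simp
  have "dihedral_elt n (i, f) \<otimes>\<^bsub>dihedral_group n\<^esub> dihedral_elt n (j, g)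
      = pres_cong (dihedral_rels n) `` {dihedral_nf (i, f) @ dihedral_nf (j, g)}"
    unfolding dihedral_elt_def dihedral_group_def presented_group_mult ..
  also have "\<dots> = dihedral_elt n (foldr (dihedral_act n) (dihedral_nf (i, f)) (j, g))"
    unfolding dihedral_elt_eval[OF n] foldr_append comp_apply foldr_dihedral_nf_one[OF assms(2)] ..
  also have "\<dots> = dihedral_elt n (((if f then n - j else j) + i) mod n, f \<noteq> g)"
    unfolding foldr_dihedral_act_nf[OF n assms(2)] ..
  finally show ?thesis .
qed

lemma odd_dvd_double_iff:
  fixes m x :: int
  assumes "odd m"
  shows "m dvd 2 * x \<longleftrightarrow> m dvd x"
proof -
  have "coprime m 2" using assms by (simp add: coprime_commute)
  then show ?thesis by (rule coprime_dvd_mult_right_iff)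
qed

text \<open>Equating the two products leaves a congruence between their rotation exponents: \<open>2 i = 2 j\<close> for
  two reflections, \<open>2 j = 0\<close> or \<open>2 i = 0\<close> for a reflection and a rotation, and nothing for two
  rotations. The factor 2 cancels modulo the odd number \<open>n\<close>.\<close>

lemma dihedral_elt_commute_iff:
  assumes "odd n" "i < n" "j < n"
  shows "dihedral_elt n (i, f) \<otimes>\<^bsub>dihedral_group n\<^esub> dihedral_elt n (j, g)
      = dihedral_elt n (j, g) \<otimes>\<^bsub>dihedral_group n\<^esub> dihedral_elt n (i, f) \<longleftrightarrow>
    (if f then if g then i = j else j = 0 else g \<longrightarrow> i = 0)"
proof -
  have n: "n > 0" using assms by simp
  have mod_eq: "x mod n = y mod n \<longleftrightarrow> int n dvd int x - int y" for x y
    by (metis mod_eq_dvd_iff of_nat_eq_iff zmod_int)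
  have small: "int n dvd x \<longleftrightarrow> x = 0" if "\<bar>x\<bar> < int n" for x
    using that by (metis dvd_0_right dvd_imp_le_int abs_of_nat not_less)
  have "((if f then n - j else j) + i) mod n = ((if g then n - i else i) + j) mod n \<longleftrightarrow>
      (if f then if g then i = j else j = 0 else g \<longrightarrow> i = 0)"
  proof (cases f; cases g)
    assume fg: f g
    have "int n dvd 2 * (int i - int j) \<longleftrightarrow> i = j"
      using assms by (subst odd_dvd_double_iff) (auto simp: small)
    then show ?thesis using fg assms by (simp add: mod_eq of_nat_diff algebra_simps)
  next
    assume fg: f "\<not> g"
    \<comment> \<open>The exponent \<open>- j\<close> is represented by \<open>n - j\<close>, hence the extra multiple of \<open>n\<close>.\<close>
    have "int n dvd 2 * (- int j) + int n \<longleftrightarrow> j = 0"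
      using assms by (subst dvd_add_left_iff, simp, subst odd_dvd_double_iff) (auto simp: small)
    then show ?thesis using fg assms by (simp add: mod_eq of_nat_diff algebra_simps)
  next
    assume fg: "\<not> f" g
    have "int n dvd 2 * int i - int n \<longleftrightarrow> i = 0"
      using assms by (subst dvd_diff_left_iff, simp, subst odd_dvd_double_iff) (auto simp: small)
    then show ?thesis using fg assms by (simp add: mod_eq of_nat_diff algebra_simps)
  qed (simp add: add.commute)
  then show ?thesis
    unfolding dihedral_elt_mult[OF assms(2,3)] dihedral_elt_mult[OF assms(3,2)]
    using n by (subst inj_on_eq_iff[OF inj_on_dihedral_elt]) auto
qed

section \<open>The non-commuting graph of an odd dihedral group\<close>

definition nontrivial_rotations :: "nat \<Rightarrow> dihedral_gen word set set" where
  "nontrivial_rotations n = dihedral_elt n ` ({1..<n} \<times> {False})"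

definition reflections :: "nat \<Rightarrow> dihedral_gen word set set" where
  "reflections n = dihedral_elt n ` ({..<n} \<times> {True})"

lemma dihedral_elt_eq_iff:
  assumes "i < n" "j < n"
  shows "dihedral_elt n (i, f) = dihedral_elt n (j, g) \<longleftrightarrow> i = j \<and> f = g"
  using inj_on_eq_iff[OF inj_on_dihedral_elt, of "(i, f)" n "(j, g)"] assms by simp

lemma rotations_reflections:
  shows "card (nontrivial_rotations n) = n - 1" "card (reflections n) = n"
    and "finite (nontrivial_rotations n)" "finite (reflections n)"
    and "nontrivial_rotations n \<inter> reflections n = {}"
proof -
  show "card (nontrivial_rotations n) = n - 1" "card (reflections n) = n"
    unfolding nontrivial_rotations_def reflections_def
    by (subst card_image; force intro: inj_on_subset[OF inj_on_dihedral_elt])+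
  show "finite (nontrivial_rotations n)" "finite (reflections n)"
    by (simp_all add: nontrivial_rotations_def reflections_def)
  show "nontrivial_rotations n \<inter> reflections n = {}"
    by (auto simp: nontrivial_rotations_def reflections_def dihedral_elt_eq_iff)
qed

text \<open>Commuting with \<open>s\<close> forces a central rotation to be trivial, and commuting with \<open>r\<close> excludes the
  reflections.\<close>

lemma group_center_dihedral_group:
  assumes "n \<ge> 3" "odd n"
  shows "group_center (dihedral_group n) = {dihedral_elt n (0, False)}"
proof (intro equalityI subsetI)
  fix z assume z: "z \<in> group_center (dihedral_group n)"
  then obtain i f where i: "i < n" and zi: "z = dihedral_elt n (i, f)"
    using assms by (auto simp: group_center_def carrier_dihedral_group)
  have comm: "if f then if g then i = j else j = 0 else g \<longrightarrow> i = 0" if "j < n" for j g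
    using z that assms i dihedral_elt_commute_iff[OF assms(2) i that, of f g]
    by (auto simp: group_center_def carrier_dihedral_group zi)
  \<comment> \<open>Test against \<open>r = (1, False)\<close> and \<open>s = (0, True)\<close>.\<close>
  show "z \<in> {dihedral_elt n (0, False)}"
    using comm[of 1 False] comm[of 0 True] assms zi by (auto split: if_splits)
next
  fix z assume "z \<in> {dihedral_elt n (0, False)}"
  then show "z \<in> group_center (dihedral_group n)"
    using assms by (auto simp: group_center_def carrier_dihedral_group dihedral_elt_commute_iff)
qed

text \<open>The hypotheses on the graph in \<open>transmission_complete_split\<close>, with the nontrivial rotations as
  the independent set.\<close>

lemma noncommuting_graph_dihedral:
  assumes "n \<ge> 3" "odd n"
  shows "pverts (noncommuting_graph (dihedral_group n))
      = nontrivial_rotations n \<union> reflections n"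
    and "u \<in> nontrivial_rotations n \<union> reflections n \<Longrightarrow>
      v \<in> nontrivial_rotations n \<union> reflections n \<Longrightarrow>
      (u, v) \<in> parcs (noncommuting_graph (dihedral_group n)) \<longleftrightarrow>
        u \<noteq> v \<and> \<not> (u \<in> nontrivial_rotations n \<and> v \<in> nontrivial_rotations n)"
proof -
  let ?V = "nontrivial_rotations n \<union> reflections n"
  have "{..<n} \<times> UNIV = insert (0, False) ({1..<n} \<times> {False} \<union> {..<n} \<times> {True})"
    using assms by (auto simp: not_le)
  then have "carrier (dihedral_group n) = insert (dihedral_elt n (0, False)) ?V"
    using assms by (simp add: carrier_dihedral_group nontrivial_rotations_def
        reflections_def image_Un)
  moreover have "dihedral_elt n (0, False) \<notin> ?V"
    by (auto simp: nontrivial_rotations_def reflections_def dihedral_elt_eq_iff)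
  ultimately have V: "carrier (dihedral_group n) - group_center (dihedral_group n) = ?V"
    using group_center_dihedral_group[OF assms] by auto
  then show "pverts (noncommuting_graph (dihedral_group n)) = ?V"
    by (simp add: noncommuting_graph_def)
  assume uv: "u \<in> ?V" "v \<in> ?V"
  have repr: "\<exists>i f. i < n \<and> (f \<or> i \<noteq> 0) \<and> w = dihedral_elt n (i, f)" if "w \<in> ?V" for w
    using that unfolding nontrivial_rotations_def reflections_def by fastforce
  obtain i f j g where "i < n" "f \<or> i \<noteq> 0" "u = dihedral_elt n (i, f)"
      and "j < n" "g \<or> j \<noteq> 0" "v = dihedral_elt n (j, g)"
    using repr[OF uv(1)] repr[OF uv(2)] by blast
  moreover have "dihedral_elt n (k, h) \<in> nontrivial_rotations n \<longleftrightarrow> k \<noteq> 0 \<and> \<not> h"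
    if "k < n" for k h
    using that by (auto simp: nontrivial_rotations_def dihedral_elt_eq_iff)
  ultimately show "(u, v) \<in> parcs (noncommuting_graph (dihedral_group n)) \<longleftrightarrow>
      u \<noteq> v \<and> \<not> (u \<in> nontrivial_rotations n \<and> v \<in> nontrivial_rotations n)"
    using uv V assms(2)
    by (auto simp: noncommuting_graph_def dihedral_elt_commute_iff dihedral_elt_eq_iff)
qed

theorem theorem4p3:
  fixes n :: nat
  assumes "n \<ge> 3" and "odd n"
  shows "mean_distance (with_proj (noncommuting_graph (dihedral_group n)))
    = ereal ((5 * real n - 4) / (4 * real n - 2))"
proof -
  let ?G = "noncommuting_graph (dihedral_group n)"
  let ?A = "nontrivial_rotations n" and ?B = "reflections n"
  interpret pair_bidirected_digraph ?G
    by (rule pair_bidirected_noncommuting_graph)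
  note V = noncommuting_graph_dihedral(1)[OF assms]
    and parts = rotations_reflections[of n]
  have "?B \<noteq> {}" using parts(2) assms by force
  then have "transmission (with_proj ?G) =
      ereal (real (card ?A) * (2 * (real (card ?A) - 1) + real (card ?B))
        + real (card ?B) * (real (card ?A) + real (card ?B) - 1))"
    using V parts noncommuting_graph_dihedral(2)[OF assms]
    by (intro transmission_complete_split) auto
  also have "\<dots> = ereal ((real n - 1) * (5 * real n - 4))"
    using assms by (simp add: parts of_nat_diff algebra_simps)
  finally have T: "transmission (with_proj ?G) = ereal ((real n - 1) * (5 * real n - 4))" .
  have "card (verts (with_proj ?G)) = 2 * n - 1"
    using V parts assms by (simp add: card_Un_disjoint)
  then have "real (card (verts (with_proj ?G))) * (real (card (verts (with_proj ?G))) - 1)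
      = (real n - 1) * (4 * real n - 2)"
    using assms by (simp add: of_nat_diff algebra_simps)
  then have "mean_distance (with_proj ?G)
      = ereal ((real n - 1) * (5 * real n - 4) / ((real n - 1) * (4 * real n - 2)))"
    using assms unfolding mean_distance_def T by simp
  then show ?thesis using assms by simp
qed

end
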